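(* Let $1<p<+\infty$, let $\Omega=(a,b)$ be a bounded open interval and let $w:\mathbb{R}\to\mathbb{R}$ satisfy $w\ge 0$ a.e. and $w\in L^1_{\rm loc}(\mathbb{R})$. Let $1\le N_w\le+\infty$. For every $u\in{\rm Dom}_w$ it holds that $$\sum_{i=1}^{N_w}\frac{1}{b_i-a_i}\int_{a_i}^{b_i}\left|u(\eta)-u\left(\frac{a_i+b_i}{2}\right)\right|^p(\hat w_p(\eta))^{p-1}\,d\eta\le\int_{I_{\Omega,w}}|u'(y)|^p\,w(y)\,dy.$$
   Context: Conventions: $w^{-1/(p-1)}=+\infty$ where $w=0$. The set $I_{\Omega,w}$: $$I_{\Omega,w}=\{x\in\Omega:\ \exists\,\epsilon>0 \text{ such that } w^{-\frac1{p-1}}\in L^1((x-\epsilon,x+\epsilon))\}.$$ It is open, and it is written as the disjoint union of its connected components, $I_{\Omega,w}=\bigcup_{i=1}^{N_w}(a_i,b_i)$, where $N_w$ is the (finite or countably infinite) number of components. The set ${\rm Dom}_w$: $${\rm Dom}_w=\Big\{u:\Omega\to\mathbb{R}:\ u\in W^{1,1}_{\rm loc}(I_{\Omega,w}),\ \int_{I_{\Omega,w}}|u'|^p\,w\,dx<+\infty\Big\}.$$ Functions in ${\rm Dom}_w$ are identified on $I_{\Omega,w}$ with their continuous (locally absolutely continuous) representative, so pointwise values on $I_{\Omega,w}$ make sense. The auxiliary weight $\hat w_p$ on each component $(a_i,b_i)$ of $I_{\Omega,w}$: $$\hat w_p(x)=\begin{cases}\left(\int_x^{\frac{a_i+b_i}2}w^{-\frac1{p-1}}(y)\,dy\right)^{-1}&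 a_i<x<\frac{3a_i+b_i}4,\\[4pt] \left(\int_{\frac{3a_i+b_i}4}^{\frac{a_i+3b_i}4}w^{-\frac1{p-1}}(y)\,dy\right)^{-1}& \frac{3a_i+b_i}4\le x\le\frac{a_i+3b_i}4,\\[4pt] \left(\int_{\frac{a_i+b_i}2}^{x}w^{-\frac1{p-1}}(y)\,dy\right)^{-1}& \frac{a_i+3b_i}4<x<b_i.\end{cases}$$ *)

theory Defs
  imports "HOL-Analysis.Analysis"
begin

text \<open>The function \<open>w\<^bsup>-1/(p-1)\<^esup>\<close>, with value \<open>\<infinity>\<close> where \<open>w = 0\<close>. The values where
  \<open>w < 0\<close> are irrelevant, since weights are nonnegative almost everywhere.\<close>

definition dual_weight :: "real \<Rightarrow> (real \<Rightarrow> real) \<Rightarrow> real \<Rightarrow> ennreal" where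
  "dual_weight p w x = (if w x = 0 then \<infinity> else ennreal (w x powr (- 1 / (p - 1))))"

definition locally_integrable_on :: "(real \<Rightarrow> real) \<Rightarrow> real set \<Rightarrow> bool"
    (infixr \<open>locally'_integrable'_on\<close> 46) where
  "f locally_integrable_on S \<longleftrightarrow> (\<forall>K. compact K \<and> K \<subseteq> S \<longrightarrow> f absolutely_integrable_on K)"

text \<open>Since \<open>dual_weight p w\<close> is measurable and nonnegative for measurable \<open>w\<close>, membership in
  \<open>L\<^sup>1\<close> amounts to finiteness of its integral.\<close>

definition I_set :: "real \<Rightarrow> real set \<Rightarrow> (real \<Rightarrow> real) \<Rightarrow> real set" where
  "I_set p \<Omega> w =
     {x \<in> \<Omega>. \<exists>\<epsilon>>0. (\<integral>\<^sup>+ y\<in>{x - \<epsilon><..<x + \<epsilon>}. dual_weight p w y \<partial>lebesgue) < \<infinity>}"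

text \<open>The space \<open>C\<^sub>c\<^sup>\<infinity>(S)\<close>, its elements being extended by zero to the whole line.\<close>

definition test_functions :: "real set \<Rightarrow> (real \<Rightarrow> real) set" where
  "test_functions S =
     {\<phi>. (\<forall>n x. ((deriv ^^ n) \<phi>) differentiable (at x)) \<and>
         (\<exists>K. compact K \<and> K \<subseteq> S \<and> (\<forall>x. x \<notin> K \<longrightarrow> \<phi> x = 0))}"

definition has_weak_derivative_on ::
    "(real \<Rightarrow> real) \<Rightarrow> (real \<Rightarrow> real) \<Rightarrow> real set \<Rightarrow> bool" where
  "has_weak_derivative_on u v S \<longleftrightarrow>
     u locally_integrable_on S \<and> v locally_integrable_on S \<and>
     (\<forall>\<phi> \<in> test_functions S.
        (LINT x:S|lebesgue. u x * deriv \<phi> x) = - (LINT x:S|lebesgue. v x * \<phi> x))"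

text \<open>Both conditions \<open>u \<in> W\<^sup>1\<^sup>,\<^sup>1\<^sub>l\<^sub>o\<^sub>c\<close> and finiteness of the weighted energy are expressed through the
  weak derivative \<open>v\<close>, which is unique up to null sets. No representative of \<open>u\<close> is chosen here,
  and the values of \<open>u\<close> outside of \<open>I_set p \<Omega> w\<close> play no role.\<close>

definition Dom :: "real \<Rightarrow> real set \<Rightarrow> (real \<Rightarrow> real) \<Rightarrow> (real \<Rightarrow> real) set" where
  "Dom p \<Omega> w =
     {u. \<exists>v. has_weak_derivative_on u v (I_set p \<Omega> w) \<and>
             (\<integral>\<^sup>+ x\<in>I_set p \<Omega> w. ennreal (\<bar>v x\<bar> powr p * w x) \<partial>lebesgue) < \<infinity>}"

definition continuous_representative_on ::
    "(real \<Rightarrow> real) \<Rightarrow> (real \<Rightarrow> real) \<Rightarrow> real set \<Rightarrow> bool" where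
  "continuous_representative_on f u S \<longleftrightarrow>
     continuous_on S f \<and> (AE x in lebesgue. x \<in> S \<longrightarrow> f x = u x)"

text \<open>The auxiliary weight on a component \<open>(\<alpha>, \<beta>)\<close> of \<open>I_set p \<Omega> w\<close>. There all the integrals below
  are finite and positive, so that the conversion to a real number is harmless.\<close>

definition hat_weight ::
    "real \<Rightarrow> (real \<Rightarrow> real) \<Rightarrow> real \<Rightarrow> real \<Rightarrow> real \<Rightarrow> real" where
  "hat_weight p w \<alpha> \<beta> x =
     inverse (enn2real
       (if x < (3 * \<alpha> + \<beta>) / 4 then
          \<integral>\<^sup>+ y\<in>{x..(\<alpha> + \<beta>) / 2}. dual_weight p w y \<partial>lebesgue
        else if x \<le> (\<alpha> + 3 * \<beta>) / 4 then
          \<integral>\<^sup>+ y\<in>{(3 * \<alpha> + \<beta>) / 4..(\<alpha> + 3 * \<beta>) / 4}. dual_weight p w y \<partial>lebesgue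
        else
          \<integral>\<^sup>+ y\<in>{(\<alpha> + \<beta>) / 2..x}. dual_weight p w y \<partial>lebesgue))"

text \<open>To be used with \<open>\<alpha> = Inf C\<close> and \<open>\<beta> = Sup C\<close>: a component \<open>C\<close> of the bounded open set
  \<open>I_set p \<Omega> w\<close> is the interval \<open>(Inf C, Sup C)\<close>.\<close>

definition component_term ::
    "real \<Rightarrow> (real \<Rightarrow> real) \<Rightarrow> (real \<Rightarrow> real) \<Rightarrow> real \<Rightarrow> real \<Rightarrow> ennreal" where
  "component_term p w u \<alpha> \<beta> =
     ennreal (1 / (\<beta> - \<alpha>)) *
     (\<integral>\<^sup>+ \<eta>\<in>{\<alpha><..<\<beta>}.
        ennreal (\<bar>u \<eta> - u ((\<alpha> + \<beta>) / 2)\<bar> powr p * hat_weight p w \<alpha> \<beta> \<eta> powr (p - 1)) \<partial>lebesgue)"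

end

theory Submission
  imports Defs "HOL-Computational_Algebra.Polynomial"
begin

text \<open>
  On a component \<open>(\<alpha>, \<beta>)\<close> with midpoint \<open>m\<close>, the continuous representative satisfies
  \<open>f \<eta> - f m = \<integral> u'\<close> over the interval between \<open>m\<close> and \<open>\<eta>\<close>: test the weak derivative with mollified
  indicators of that interval. By Hoelder, \<open>\<bar>f \<eta> - f m\<bar>\<^sup>p\<close> is at most the energy of \<open>u'\<close> there times the
  \<open>(p - 1)\<close>-st power of the integral of the dual weight, and the auxiliary weight is chosen to cancel
  the latter factor. So the integrand at every \<open>\<eta>\<close> is bounded by the energy on the whole component;
  averaging over \<open>\<eta>\<close> and summing over the disjoint components gives the claim.
\<close>

section \<open>Smooth bump functions and a smooth step\<close>

text \<open>Smoothness is expressed through the iterates of \<open>deriv\<close>, and an induction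
  on them needs an invariant: membership in a family closed under \<open>deriv\<close>. This serves
  both for the smooth step and for the mollified indicators.\<close>

lemma derivs_differentiable_if_closed:
  fixes f :: "real \<Rightarrow> real"
  assumes "f \<in> F"
    and closed: "\<And>g. g \<in> F \<Longrightarrow> (\<forall>x. g differentiable at x) \<and> deriv g \<in> F"
  shows "((deriv ^^ n) f) differentiable (at x)"
proof -
  have "(deriv ^^ n) f \<in> F"
    by (induction n) (use assms in auto)
  then show ?thesis
    using closed by blast
qed

text \<open>The family is closed under differentiation, which makes each of its members smooth.\<close>

definition bump :: "real poly \<Rightarrow> nat \<Rightarrow> real \<Rightarrow> real" where
  "bump P k t =
     (if \<bar>t\<bar> < 1 then poly P t / (1 - t\<^sup>2) ^ k * exp (- 1 / (1 - t\<^sup>2)) else 0)"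

text \<open>With q = 1 - t^2, a single Taylor term of exp (1/q) gives exp (-1/q) \<le> (k+2)!
  q^(k+2), and dividing by q^k leaves q^2. This double zero at |t| = 1 is what forces the derivative
  to vanish there.\<close>

lemma bump_le_square: "\<exists>M\<ge>0. \<forall>t. \<bar>bump P k t\<bar> \<le> M * (1 - t\<^sup>2)\<^sup>2"
proof -
  have "continuous_on {-1..1::real} (poly P)"
    by (intro continuous_intros)
  then have "compact (poly P ` {-1..1::real})"
    by (rule compact_continuous_image) simp
  then obtain B where B: "\<And>t. t \<in> {-1..1} \<Longrightarrow> \<bar>poly P t\<bar> \<le> B"
    by (metis compact_imp_bounded bounded_iff imageI real_norm_def)
  have "0 \<le> B"
    using B[of 0] by simp
  have "\<bar>bump P k t\<bar> \<le> B * fact (k + 2) * (1 - t\<^sup>2)\<^sup>2" if t: "\<bar>t\<bar> < 1" for t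
  proof -
    define q where "q = 1 - t\<^sup>2"
    have q: "0 < q"
      using t unfolding q_def by (simp add: abs_square_less_1)
    \<comment> \<open>The sum contains the index \<open>k + 2\<close> and the Lagrange remainder is
      positive, so the one term of that index bounds the exponential from below.\<close>
    obtain s where s: "exp (1 / q) = (\<Sum>m<k + 3. (1 / q) ^ m / fact m) + exp s / fact (k + 3) * (1 / q) ^ (k + 3)"
      using Maclaurin_exp_le[of "1 / q" "k + 3"] by blast
    have "(1 / q) ^ (k + 2) / fact (k + 2) \<le> (\<Sum>m<k + 3. (1 / q) ^ m / fact m)"
      using q by (intro member_le_sum) auto
    also have "\<dots> \<le> exp (1 / q)"
      unfolding s using q by simp
    finally have "(1 / q) ^ (k + 2) / fact (k + 2) \<le> exp (1 / q)" .
    then have "exp (- 1 / q) \<le> fact (k + 2) * q ^ (k + 2)"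
      using q by (simp add: exp_minus field_simps del: fact_Suc power_Suc)
    then have "exp (- 1 / q) / q ^ k \<le> fact (k + 2) * q\<^sup>2"
      using q by (simp add: power_add power2_eq_square field_simps)
    then have "\<bar>poly P t\<bar> * (exp (- 1 / q) / q ^ k) \<le> B * (fact (k + 2) * q\<^sup>2)"
      using B[of t] less_imp_le[OF t] \<open>0 \<le> B\<close> q by (intro mult_mono) (auto simp: abs_le_iff abs_less_iff)
    then show ?thesis
      using t q by (simp add: bump_def q_def[symmetric] abs_mult mult_ac)
  qed
  then show ?thesis
    using \<open>0 \<le> B\<close> by (intro exI[of _ "B * fact (k + 2)"]) (auto simp: bump_def)
qed

text \<open>\<open>[:1, 0, -1:]\<close> is 1 - t^2 and \<open>[:0, 1:]\<close> is t, so inside (-1,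
  1) this is the quotient rule over the common denominator (1 - t^2)^(k+2). For |t| > 1 the function
  is locally zero, and at |t| = 1 the difference quotient is estimated directly.\<close>

lemma bump_has_derivative:
  "(bump P k has_real_derivative
     bump (pderiv P * [:1, 0, -1:] ^ 2 + smult (2 * real k) (P * [:0, 1:] * [:1, 0, -1:])
           - smult 2 (P * [:0, 1:])) (k + 2) t) (at t)"
    (is "(_ has_real_derivative bump ?P' _ _) _")
proof -
  consider "\<bar>t\<bar> < 1" | "\<bar>t\<bar> > 1" | "\<bar>t\<bar> = 1"
    by linarith
  then show ?thesis
  proof cases
    case 1
    have q: "0 < 1 - t\<^sup>2"
      using 1 by (simp add: abs_square_less_1)
    define Q where "Q = (\<lambda>t::real. 1 - t\<^sup>2)"
    have Q: "Q t \<noteq> 0" and DQ: "(Q has_real_derivative - 2 * t) (at t)"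
      using q by (auto simp: Q_def intro!: derivative_eq_intros)
    have D: "((\<lambda>t. poly P t / Q t ^ k * exp (- 1 / Q t)) has_real_derivative
        (poly (pderiv P) t * Q t ^ k - poly P t * (real k * Q t ^ (k - 1) * (- 2 * t))) / (Q t ^ k * Q t ^ k)
          * exp (- 1 / Q t)
        + poly P t / Q t ^ k * (exp (- 1 / Q t) * (- 2 * t / (Q t)\<^sup>2))) (at t)"
      by (rule derivative_eq_intros poly_DERIV DQ refl | use Q in \<open>simp add: power2_eq_square mult_ac\<close>)+
    \<comment> \<open>Replacing \<open>Q t\<close> by a nonzero \<open>r\<close> leaves pure
      algebra. The split on \<open>k\<close> deals with the truncated \<open>k - 1\<close>: for k =
      0 the factor \<open>real k\<close> removes that term.\<close>
    have eq: "(p' * r ^ k - p * (real k * r ^ (k - 1) * (- 2 * t))) / (r ^ k * r ^ k) * E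
        + p / r ^ k * (E * (- 2 * t / r\<^sup>2))
      = (p' * r\<^sup>2 + 2 * real k * (p * t * r) - 2 * (p * t)) / r ^ (k + 2) * E"
      if "r \<noteq> 0" for r p p' E :: real
      using that by (cases k) (simp_all add: field_simps power2_eq_square)
    have polyQ: "poly [:1, 0, -1:] t = Q t"
      by (simp add: Q_def power2_eq_square)
    have "((\<lambda>t. poly P t / Q t ^ k * exp (- 1 / Q t)) has_real_derivative
             bump ?P' (k + 2) t) (at t)"
    proof -
      have "poly ?P' t = poly (pderiv P) t * (Q t)\<^sup>2 + 2 * real k * (poly P t * t * Q t) - 2 * (poly P t * t)"
        unfolding poly_add poly_diff poly_smult poly_mult poly_power polyQ by simp
      from this[unfolded Q_def] show ?thesis
        using D[unfolded eq[OF Q]] 1 unfolding bump_def Q_def by (simp only: if_True)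
    qed
    then show ?thesis
      by (rule has_field_derivative_transform_within_open[of _ _ _ "{-1<..<1}"])
         (use 1 in \<open>auto simp: bump_def Q_def\<close>)
  next
    case 2
    have "((\<lambda>t. 0) has_real_derivative bump ?P' (k + 2) t) (at t)"
      using 2 by (simp add: bump_def)
    then show ?thesis
      by (rule has_field_derivative_transform_within_open[of _ _ _ "{..<-1} \<union> {1<..}"])
         (use 2 in \<open>auto simp: bump_def\<close>)
  next
    case 3
    obtain M where M: "0 \<le> M" "\<And>t. \<bar>bump P k t\<bar> \<le> M * (1 - t\<^sup>2)\<^sup>2"
      using bump_le_square by blast
    \<comment> \<open>The value at \<open>t\<close> is 0, and t^2 = 1 gives 1 - (t+h)^2 = -h (2t +
      h) with |2t + h| \<le> 2 whenever |t + h| < 1. The quadratic bound is then M (2|h|)^2, and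
      division by |h| leaves 4 M |h|.\<close>
    have bound: "\<bar>(bump P k (t + h) - bump P k t) / h\<bar> \<le> 4 * M * \<bar>h\<bar>" if "h \<noteq> 0" for h
    proof (cases "\<bar>t + h\<bar> < 1")
      case True
      have "\<bar>1 - (t + h)\<^sup>2\<bar> = \<bar>h\<bar> * \<bar>2 * t + h\<bar>"
      proof -
        have "t * t = 1"
          using 3 by (auto simp: abs_if split: if_splits)
        then have "1 - (t + h)\<^sup>2 = - (h * (2 * t + h))"
          by (simp add: power2_eq_square algebra_simps)
        then show ?thesis
          by (simp add: abs_mult)
      qed
      also have "\<dots> \<le> \<bar>h\<bar> * 2"
        using 3 True by (intro mult_left_mono) auto
      finally have "\<bar>1 - (t + h)\<^sup>2\<bar> \<le> 2 * \<bar>h\<bar>"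
        by simp
      then have "(1 - (t + h)\<^sup>2)\<^sup>2 \<le> (2 * \<bar>h\<bar>)\<^sup>2"
        by (metis abs_ge_zero power2_abs power_mono)
      then have "\<bar>bump P k (t + h)\<bar> \<le> M * (2 * \<bar>h\<bar>)\<^sup>2"
        using M order_trans mult_left_mono by blast
      then show ?thesis
        using that 3 by (simp add: bump_def[of _ _ t] field_simps power2_eq_square)
    qed (use 3 M in \<open>simp add: bump_def\<close>)
    have "(\<lambda>h. (bump P k (t + h) - bump P k t) / h) \<midarrow>0\<rightarrow> 0"
    proof (rule Lim_null_comparison)
      show "\<forall>\<^sub>F h in at 0. norm ((bump P k (t + h) - bump P k t) / h) \<le> 4 * M * \<bar>h\<bar>"
        using bound by (auto simp: eventually_at_filter)
      show "((\<lambda>h. 4 * M * \<bar>h\<bar>) \<longlongrightarrow> 0) (at 0)"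
        by (rule tendsto_eq_intros refl | simp)+
    qed
    moreover have "bump ?P' (k + 2) t = 0"
      using 3 by (simp add: bump_def)
    ultimately show ?thesis
      by (simp only: DERIV_def)
  qed
qed

text \<open>Take the primitive of \<open>bump 1 0\<close> divided by its total mass. Its derivative
  is then a nonnegative kernel of mass one, which acts as the mollifier below.\<close>

lemma exists_smooth_step:
  "\<exists>R :: real \<Rightarrow> real. (\<forall>n x. ((deriv ^^ n) R) differentiable (at x)) \<and> (\<forall>t. 0 \<le> deriv R t)
     \<and> (\<forall>t. 1 \<le> \<bar>t\<bar> \<longrightarrow> deriv R t = 0) \<and> (\<forall>t. 0 \<le> R t \<and> R t \<le> 1) \<and> (\<forall>t\<le>-1. R t = 0) \<and> (\<forall>t\<ge>1. R t = 1)"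
proof -
  define \<rho> where "\<rho> = bump 1 0"
  \<comment> \<open>The base point -2 lies strictly to the left of the support, so every t \<ge> -1
    is interior to \<open>{-2..t+1}\<close> and the one-sided derivative there is two-sided.\<close>
  define S where "S t = integral {-2..t} \<rho>" for t
  have cont: "continuous_on A \<rho>" for A
    unfolding \<rho>_def by (meson DERIV_continuous_on bump_has_derivative has_field_derivative_at_within)
  have nonneg: "0 \<le> \<rho> t" for t
    by (simp add: \<rho>_def bump_def)
  have S_low: "S t = 0" if "t \<le> -1" for t
  proof -
    have "integral {-2..t} \<rho> = integral {-2..t} (\<lambda>_. 0)"
      using that by (intro integral_cong) (auto simp: \<rho>_def bump_def)
    then show ?thesis
      by (simp add: S_def)
  qed
  have S_deriv: "(S has_real_derivative \<rho> t) (at t)" for t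
  proof (cases "t < -1")
    case True
    have "((\<lambda>_. 0) has_real_derivative \<rho> t) (at t)"
      using True by (simp add: \<rho>_def bump_def)
    then show ?thesis
      by (rule has_field_derivative_transform_within_open[of _ _ _ "{..<-1}"])
         (use True S_low in auto)
  next
    case False
    have "(S has_real_derivative \<rho> t) (at t within {-2..t+1})"
      unfolding S_def by (rule integral_has_real_derivative) (use False cont in auto)
    then show ?thesis
      using False by (simp add: at_within_Icc_at)
  qed
  have S_high: "S t = S 1" if "1 \<le> t" for t
  proof -
    have "integral {-2..1} \<rho> + integral {1..t} \<rho> = integral {-2..t} \<rho>"
      by (rule Henstock_Kurzweil_Integration.integral_combine)
         (use that cont in \<open>auto intro: integrable_continuous_real\<close>)
    moreover have "integral {1..t} \<rho> = integral {1..t} (\<lambda>_. 0)"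
      by (intro integral_cong) (auto simp: \<rho>_def bump_def)
    ultimately show ?thesis
      by (simp add: S_def)
  qed
  have S_pos: "0 < S 1"
  proof -
    have "S 1 \<noteq> 0"
    proof
      assume "S 1 = 0"
      then have "integral {-2..1} \<rho> = 0"
        by (simp add: S_def)
      then have "\<rho> 0 = 0"
        using integral_eq_0_iff[of "-2" 1 \<rho>] cont nonneg by auto
      then show False
        by (simp add: \<rho>_def bump_def)
    qed
    moreover have "0 \<le> S 1"
      unfolding S_def using nonneg by (intro integral_nonneg integrable_continuous_real cont) auto
    ultimately show ?thesis
      by simp
  qed
  define R where "R t = S t / S 1" for t
  have R_deriv: "(R has_real_derivative \<rho> t / S 1) (at t)" for t
    unfolding R_def by (rule DERIV_cdivide[OF S_deriv])
  \<comment> \<open>The derivative of \<open>R\<close> is a bump divided by \<open>S 1\<close>,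
    hence the quotients by constants; \<open>bump_has_derivative\<close> keeps these within the
    family.\<close>
  define F where "F = insert R {\<lambda>t. bump P k t / c | P k c. True}"
  have "((deriv ^^ n) R) differentiable (at x)" for n x
  proof (rule derivs_differentiable_if_closed)
    show "R \<in> F"
      by (simp add: F_def)
    fix g
    assume "g \<in> F"
    then consider "g = R" | P k c where "g = (\<lambda>t. bump P k t / c)"
      by (auto simp: F_def)
    then show "(\<forall>x. g differentiable at x) \<and> deriv g \<in> F"
    proof cases
      case 1
      have "deriv R = (\<lambda>t. \<rho> t / S 1)"
        using R_deriv by (auto intro: DERIV_imp_deriv)
      then show ?thesis
        using R_deriv 1 by (auto simp: F_def \<rho>_def real_differentiable_def)
    next
      case 2
      note D = DERIV_cdivide[OF bump_has_derivative[of P k], where c = c]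
      then have "deriv g = (\<lambda>t. bump (pderiv P * [:1, 0, -1:] ^ 2
           + smult (2 * real k) (P * [:0, 1:] * [:1, 0, -1:])
           - smult 2 (P * [:0, 1:])) (k + 2) t / c)"
        unfolding 2 by (intro ext DERIV_imp_deriv D)
      then show ?thesis
        using D 2 by (auto simp: F_def real_differentiable_def)
    qed
  qed
  moreover have "deriv R t = \<rho> t / S 1" for t
    using R_deriv by (rule DERIV_imp_deriv)
  moreover have "R t = 0" if "t \<le> -1" for t
    using S_low that by (simp add: R_def)
  moreover have "R t = 1" if "1 \<le> t" for t
    using S_high[OF that] S_pos by (simp add: R_def)
  moreover have "\<rho> t = 0" if "1 \<le> \<bar>t\<bar>" for t
    using that by (simp add: \<rho>_def bump_def)
  moreover have mono: "R s \<le> R t" if "s \<le> t" for s t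
    by (rule DERIV_nonneg_imp_nondecreasing[OF that])
      (use R_deriv nonneg S_pos in \<open>force intro!: divide_nonneg_pos\<close>)
  moreover have "0 \<le> R t \<and> R t \<le> 1" for t
    using mono[of "-1" t] mono[of t 1] calculation(3)[of "-1"] calculation(3)[of t]
      calculation(4)[of 1] calculation(4)[of t] by linarith
  ultimately show ?thesis
    using nonneg S_pos by (intro exI[of _ R]) auto
qed

section \<open>Measurability and mollification\<close>

text \<open>Integrability on compact sets gives measurability there only. Exhausting the open set by
  compact sets exhibits the product as a pointwise limit of measurable functions.\<close>

lemma locally_integrable_on_measurable:
  fixes f :: "real \<Rightarrow> real"
  assumes "f locally_integrable_on S" "open S"
  shows "(\<lambda>x. indicator S x * f x) \<in> borel_measurable lebesgue"
proof -
  obtain K :: "nat \<Rightarrow> real set" where K: "\<And>n. compact (K n)" "\<And>n. K n \<subseteq> S"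
    "\<And>T. \<lbrakk>compact T; T \<subseteq> S\<rbrakk> \<Longrightarrow> \<exists>N. \<forall>n\<ge>N. T \<subseteq> K n"
  proof (rule open_Union_compact_subsets[OF \<open>open S\<close>])
    fix C :: "nat \<Rightarrow> real set"
    assume "\<And>n. compact (C n)" "\<And>n. C n \<subseteq> S"
      "\<And>T. \<lbrakk>compact T; T \<subseteq> S\<rbrakk> \<Longrightarrow> \<exists>N. \<forall>n\<ge>N. T \<subseteq> C n"
    then show thesis
      by (rule that)
  qed
  show ?thesis
  proof (rule borel_measurable_LIMSEQ_real)
    show "(\<lambda>x. indicator (K n) x * f x) \<in> borel_measurable lebesgue" for n
    proof -
      have "f absolutely_integrable_on K n"
        using assms(1) K(1,2) by (auto simp: locally_integrable_on_def)
      then show ?thesis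
        unfolding set_integrable_def by (auto dest: borel_measurable_integrable)
    qed
    show "(\<lambda>n. indicator (K n) x * f x) \<longlonglongrightarrow> indicator S x * f x" for x
    proof (cases "x \<in> S")
      case True
      then obtain N where "\<And>n. n \<ge> N \<Longrightarrow> x \<in> K n"
        using K(3)[of "{x}"] by auto
      then have "\<forall>\<^sub>F n in sequentially. indicator S x * f x = indicator (K n) x * f x"
        using True by (auto simp: eventually_sequentially intro!: exI[of _ N])
      then show ?thesis
        by (rule Lim_transform_eventually[OF tendsto_const])
    next
      case False
      then have "x \<notin> K n" for n
        using K(2) by auto
      with False show ?thesis
        by simp
    qed
  qed
qed

text \<open>The rescaled \<open>R'\<close> is an approximate identity: nonnegative, of mass one, and
  zero at distance more than \<open>e n\<close> from \<open>x\<close>. The integral thus averages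
  \<open>f\<close> over points that approach \<open>x\<close>.\<close>

lemma smooth_step_integral_tendsto:
  fixes f R :: "real \<Rightarrow> real"
  assumes R: "\<And>t. (R has_real_derivative R' t) (at t)" "\<And>t. 0 \<le> R' t"
      "\<And>t. t \<le> -1 \<Longrightarrow> R t = 0" "\<And>t. t \<ge> 1 \<Longrightarrow> R t = 1" "\<And>t. 1 \<le> \<bar>t\<bar> \<Longrightarrow> R' t = 0"
    and contR': "continuous_on UNIV R'"
    and "\<delta> > 0" and contf: "continuous_on {x - \<delta>..x + \<delta>} f"
    and e: "e \<longlonglongrightarrow> 0" "\<And>n. 0 < e n" "\<And>n. e n \<le> \<delta>"
  shows "(\<lambda>n. LINT t:{x - \<delta>..x + \<delta>}|lebesgue. f t * (R' ((t - x) / e n) / e n)) \<longlonglongrightarrow> f x"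
proof (rule LIMSEQ_I)
  fix r :: real
  assume "0 < r"
  then obtain d where d: "0 < d" "\<And>t. \<lbrakk>t \<in> {x - \<delta>..x + \<delta>}; \<bar>t - x\<bar> < d\<rbrakk> \<Longrightarrow> \<bar>f t - f x\<bar> < r / 2"
    using contf[unfolded continuous_on_iff, rule_format, of x "r / 2"] \<open>\<delta> > 0\<close>
    by (auto simp: dist_real_def)
  obtain N where N: "\<And>n. n \<ge> N \<Longrightarrow> e n < d"
    using LIMSEQ_D[OF e(1) d(1)] e(2) by (auto simp: abs_of_pos)
  have "norm ((LINT t:{x - \<delta>..x + \<delta>}|lebesgue. f t * (R' ((t - x) / e n) / e n)) - f x) < r"
    if "n \<ge> N" for n
  proof -
    define k where "k t = R' ((t - x) / e n) / e n" for t
    have k_nonneg: "0 \<le> k t" for t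
      using R(2) e(2)[of n] by (simp add: k_def)
    have k_cont: "continuous_on A k" for A
      unfolding k_def using e(2)[of n]
      by (intro continuous_intros continuous_on_compose2[OF contR']) auto
    have k_out: "k t = 0" if "\<bar>t - x\<bar> > e n" for t
    proof -
      have "1 \<le> \<bar>(t - x) / e n\<bar>"
        using that e(2)[of n] by (simp add: abs_divide)
      then show ?thesis
        using R(5) by (simp add: k_def)
    qed
    \<comment> \<open>The primitive of the kernel is the rescaled step, which has already reached 0
      and 1 at the two ends because \<open>e n\<close> is at most \<delta>.\<close>
    have "(k has_integral R ((x + \<delta> - x) / e n) - R ((x - \<delta> - x) / e n)) {x - \<delta>..x + \<delta>}"
    proof (rule fundamental_theorem_of_calculus)
      show "((\<lambda>t. R ((t - x) / e n)) has_vector_derivative k t) (at t within {x - \<delta>..x + \<delta>})" for t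
        unfolding has_real_derivative_iff_has_vector_derivative[symmetric] k_def
        by (rule has_field_derivative_at_within, rule DERIV_chain'[OF _ R(1), THEN DERIV_cong])
           (use e(2)[of n] in \<open>auto intro!: derivative_eq_intros\<close>)
    qed (use \<open>\<delta> > 0\<close> in auto)
    moreover have "R ((x + \<delta> - x) / e n) = 1" "R ((x - \<delta> - x) / e n) = 0"
      using e(2,3)[of n] by (auto intro!: R(3,4) simp: field_simps)
    ultimately have k_int: "(k has_integral 1) {x - \<delta>..x + \<delta>}"
      by simp
    have fk: "(\<lambda>t. f t * k t) absolutely_integrable_on {x - \<delta>..x + \<delta>}"
      by (intro absolutely_integrable_continuous_real continuous_intros contf k_cont)
    have "((\<lambda>t. f t * k t - f x * k t) has_integral
        (LINT t:{x - \<delta>..x + \<delta>}|lebesgue. f t * k t) - f x * 1) {x - \<delta>..x + \<delta>}"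
      by (intro has_integral_diff has_integral_mult_right k_int has_integral_set_lebesgue fk)
    \<comment> \<open>Either the kernel vanishes or |t - x| \<le> \<open>e n\<close> < d, where
      \<open>f\<close> differs from \<open>f x\<close> by less than r / 2.\<close>
    moreover have "norm (f t * k t - f x * k t) \<le> r / 2 * k t" if t: "t \<in> {x - \<delta>..x + \<delta>}" for t
    proof (cases "\<bar>t - x\<bar> > e n")
      case False
      then have "\<bar>f t - f x\<bar> \<le> r / 2"
        using d(2)[OF t] N[OF \<open>n \<ge> N\<close>] by simp
      then have "\<bar>f t - f x\<bar> * k t \<le> r / 2 * k t"
        using k_nonneg by (rule mult_right_mono)
      then show ?thesis
        using k_nonneg[of t] by (simp add: left_diff_distrib[symmetric] abs_mult)
    qed (simp add: k_out)
    moreover have "((\<lambda>t. r / 2 * k t) has_integral r / 2 * 1) {x - \<delta>..x + \<delta>}"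
      by (intro has_integral_mult_right k_int)
    ultimately have "norm ((LINT t:{x - \<delta>..x + \<delta>}|lebesgue. f t * k t) - f x * 1) \<le> r / 2 * 1"
      using integral_norm_bound_integral[of "\<lambda>t. f t * k t - f x * k t" "{x - \<delta>..x + \<delta>}" "\<lambda>t. r / 2 * k t"]
      using \<open>0 < r\<close> by (simp add: has_integral_iff)
    then show ?thesis
      using \<open>0 < r\<close> by (simp add: k_def)
  qed
  then show "\<exists>N. \<forall>n\<ge>N. norm ((LINT t:{x - \<delta>..x + \<delta>}|lebesgue. f t * (R' ((t - x) / e n) / e n)) - f x) < r"
    by blast
qed

section \<open>Hoelder's inequality for the weighted energy\<close>

text \<open>With s = W^(-1/(p-1)), apply Young's inequality to V / s and c^(p-1) with the conjugate
  exponents p and p/(p-1), then multiply by p s; the identity s^(1-p) = W restores the weight. The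
  parameter \<open>c\<close> stays free so that it can be optimised after integration.\<close>

lemma weighted_Young:
  fixes p c W V :: real
  assumes "1 < p" "0 \<le> c" "0 < W" "0 \<le> V"
  shows "p * c powr (p - 1) * V \<le> V powr p * W + (p - 1) * c powr p * W powr (- 1 / (p - 1))"
proof -
  define s where "s = W powr (- 1 / (p - 1))"
  have s: "0 < s"
    using assms by (simp add: s_def)
  have "- 1 / (p - 1) * (1 - p) = 1"
    using assms by (simp add: field_simps)
  then have "s powr (1 - p) = W"
    using assms by (simp only: s_def powr_powr) simp
  then have W: "s * s powr (- p) = W"
    using s by (metis powr_add powr_one_eq_one powr_one less_imp_le add_uminus_conv_diff)
  have "V / s * c powr (p - 1) \<le> (V / s) powr p / p + (c powr (p - 1)) powr (p / (p - 1)) / (p / (p - 1))"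
    using assms s by (intro Youngs_inequality) (auto simp: field_simps)
  also have "(c powr (p - 1)) powr (p / (p - 1)) = c powr p"
    using assms by (simp add: powr_powr)
  also have "(V / s) powr p = V powr p * s powr (- p)"
    using assms s powr_divide[of V s p] by (simp add: powr_minus_divide)
  finally have "p * s * (V / s * c powr (p - 1))
      \<le> p * s * (V powr p * s powr (- p) / p + c powr p / (p / (p - 1)))"
    using assms s by (intro mult_left_mono) auto
  also have "\<dots> = V powr p * (s * s powr (- p)) + (p - 1) * c powr p * s"
    using assms by (simp add: field_simps)
  finally show ?thesis
    using s unfolding W by (simp add: s_def mult_ac)
qed

lemma dual_weight_measurable:
  assumes "w \<in> borel_measurable M"
  shows "dual_weight p w \<in> borel_measurable M"
  unfolding dual_weight_def[abs_def] using assms by measurable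

text \<open>Hoelder's inequality, divided by the power of the dual integral. If that integral is zero or
  infinite, then \<open>enn2real\<close> and \<open>inverse\<close> turn the left-hand side into \<open>0\<close>.\<close>

lemma powr_bound_by_energy:
  fixes p I :: real and v w :: "real \<Rightarrow> real"
  assumes p: "1 < p"
    and w: "AE x in lebesgue. 0 \<le> w x" "w \<in> borel_measurable lebesgue"
    and v: "v absolutely_integrable_on K"
    and K: "K \<subseteq> K'" "K \<in> sets lebesgue"
    and I: "0 \<le> I" "I \<le> (LINT t:K|lebesgue. \<bar>v t\<bar>)"
  shows "ennreal (I powr p * inverse (enn2real (\<integral>\<^sup>+ y\<in>K'. dual_weight p w y \<partial>lebesgue)) powr (p - 1))
    \<le> (\<integral>\<^sup>+ y\<in>K. ennreal (\<bar>v y\<bar> powr p * w y) \<partial>lebesgue)"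
proof -
  define b where "b = enn2real (\<integral>\<^sup>+ y\<in>K'. dual_weight p w y \<partial>lebesgue)"
  show ?thesis
  proof (cases "b = 0")
    case True
    then show ?thesis
      unfolding b_def[symmetric] by simp
  next
    case False
    then have b: "0 < b"
      by (simp add: b_def order_less_le)
    then have fin: "(\<integral>\<^sup>+ y\<in>K'. dual_weight p w y \<partial>lebesgue) = ennreal b"
      unfolding b_def by (metis ennreal_enn2real enn2real_positive_iff)
    \<comment> \<open>The choice of \<open>c\<close> for which integrating Young's inequality gives the optimal bound.\<close>
    define c where "c = I / b"
    have c: "0 \<le> c"
      using I b by (simp add: c_def)
    have [measurable]: "w \<in> borel_measurable lebesgue" "K \<in> sets lebesgue"
      using w K by auto
    have [measurable]: "dual_weight p w \<in> borel_measurable lebesgue"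
      using w by (intro dual_weight_measurable)
    have vK: "integrable lebesgue (\<lambda>t. indicator K t * v t)"
      using v by (simp add: set_integrable_def)
    then have [measurable]: "(\<lambda>t. indicator K t * v t) \<in> borel_measurable lebesgue"
      by (rule borel_measurable_integrable)
    \<comment> \<open>Measurability of \<open>v\<close> is known only after multiplication by the
      indicator of \<open>K\<close>, so the indicator moves inside the power, using 0 powr p =
      0.\<close>
    have eq: "ennreal (\<bar>v y\<bar> powr p * w y) * indicator K y
        = ennreal (\<bar>indicator K y * v y\<bar> powr p * w y)" for y
      using p by (simp split: split_indicator)
    let ?d = "\<lambda>y. ennreal ((p - 1) * c powr p) * (dual_weight p w y * indicator K y)"
    have "ennreal (p * c powr (p - 1)) * ennreal I
        \<le> ennreal (p * c powr (p - 1)) * ennreal (LINT t|lebesgue. \<bar>indicator K t * v t\<bar>)"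
      using I p by (intro mult_left_mono ennreal_leI) (auto simp: set_lebesgue_integral_def abs_mult)
    also have "ennreal (LINT t|lebesgue. \<bar>indicator K t * v t\<bar>)
        = (\<integral>\<^sup>+ t. ennreal \<bar>indicator K t * v t\<bar> \<partial>lebesgue)"
      using vK by (intro nn_integral_eq_integral[symmetric]) auto
    also have "ennreal (p * c powr (p - 1)) * \<dots>
        = (\<integral>\<^sup>+ t. ennreal (p * c powr (p - 1)) * ennreal \<bar>indicator K t * v t\<bar> \<partial>lebesgue)"
      by (rule nn_integral_cmult[symmetric]) measurable
    also have "\<dots> \<le> (\<integral>\<^sup>+ y. ennreal (\<bar>indicator K y * v y\<bar> powr p * w y) + ?d y \<partial>lebesgue)"
    proof (rule nn_integral_mono_AE, use w(1) in eventually_elim)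
      case (elim t)
      \<comment> \<open>Where the weight vanishes and c > 0, the dual term is infinite and the bound
        is trivial; for c = 0 the left-hand side is 0. Young's inequality is needed only for
        positive weight.\<close>
      consider "t \<notin> K" | "c = 0" | "t \<in> K" "c > 0" "w t = 0" | "t \<in> K" "w t > 0"
        using elim c by force
      then show ?case
      proof cases
        case 3
        then have "?d t = \<infinity>"
          using p by (simp add: dual_weight_def ennreal_mult_top)
        then show ?thesis
          by simp
      next
        case 4
        have "ennreal (p * c powr (p - 1)) * ennreal \<bar>v t\<bar> = ennreal (p * c powr (p - 1) * \<bar>v t\<bar>)"
          using p by (simp add: ennreal_mult)
        also have "\<dots> \<le> ennreal (\<bar>v t\<bar> powr p * w t + (p - 1) * c powr p * w t powr (- 1 / (p - 1)))"
          using p c 4 by (intro ennreal_leI weighted_Young) auto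
        also have "\<dots> = ennreal (\<bar>v t\<bar> powr p * w t) + ennreal ((p - 1) * c powr p) * dual_weight p w t"
          using p 4 by (simp add: dual_weight_def ennreal_mult'' ennreal_plus)
        finally show ?thesis
          using 4 by simp
      qed (use p in auto)
    qed
    also have "\<dots> = (\<integral>\<^sup>+ y. ennreal (\<bar>indicator K y * v y\<bar> powr p * w y) \<partial>lebesgue)
        + ennreal ((p - 1) * c powr p) * (\<integral>\<^sup>+ y\<in>K. dual_weight p w y \<partial>lebesgue)"
      by (subst nn_integral_add) (auto simp: nn_integral_cmult)
    \<comment> \<open>Only the dual integral passes to the larger set \<open>K'\<close>; the energy
      stays on \<open>K\<close>.\<close>
    also have "\<dots> \<le> (\<integral>\<^sup>+ y. ennreal (\<bar>indicator K y * v y\<bar> powr p * w y) \<partial>lebesgue)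
        + ennreal ((p - 1) * c powr p) * ennreal b"
      unfolding fin[symmetric]
      by (intro add_left_mono mult_left_mono nn_integral_mono) (use K in \<open>auto split: split_indicator\<close>)
    finally have *: "ennreal (p * c powr (p - 1) * I) \<le>
        (\<integral>\<^sup>+ y\<in>K. ennreal (\<bar>v y\<bar> powr p * w y) \<partial>lebesgue) + ennreal ((p - 1) * c powr p * b)"
      unfolding eq using p I b by (simp add: ennreal_mult)
    have cp: "c powr p = c powr (p - 1) * c"
      using c by (cases "c = 0") (simp_all add: powr_diff)
    \<comment> \<open>For c = I / b the quantities c^(p-1) I and c^p b coincide, so p copies minus p
      - 1 copies leave one.\<close>
    have "p * c powr (p - 1) * I - (p - 1) * c powr p * b = c powr p * b"
      unfolding cp using b by (simp add: c_def field_simps)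
    also have "\<dots> = I powr p * inverse b powr (p - 1)"
      using I b by (simp add: c_def powr_divide powr_diff powr_minus inverse_powr field_simps)
    finally have eq': "I powr p * inverse b powr (p - 1) = p * c powr (p - 1) * I - (p - 1) * c powr p * b" ..
    show ?thesis
      unfolding b_def[symmetric] eq'
      using * p b by (subst ennreal_minus[symmetric]) (auto intro: ennreal_minus_le_iff[THEN iffD2] simp: add.commute)
  qed
qed

section \<open>The increment formula for weak derivatives\<close>

text \<open>The derivative of a mollified indicator of [x, y] is a difference of two approximate
  identities, at \<open>x\<close> and at \<open>y\<close>. Continuity of \<open>f\<close> turns the
  left side of the weak identity into \<open>f x - f y\<close>, while dominated convergence treats
  the right side.\<close>

lemma continuous_representative_increment:
  assumes "open S" and weak: "has_weak_derivative_on u v S"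
    and rep: "continuous_representative_on f u S"
    and "x < y" and xyS: "{x..y} \<subseteq> S"
  shows "f y - f x = (LINT t:{x..y}|lebesgue. v t)"
proof -
  obtain R :: "real \<Rightarrow> real" where R: "\<And>n x. ((deriv ^^ n) R) differentiable (at x)"
      "\<And>t. 0 \<le> deriv R t" "\<And>t. 1 \<le> \<bar>t\<bar> \<Longrightarrow> deriv R t = 0" "\<And>t. 0 \<le> R t \<and> R t \<le> 1"
      "\<And>t. t \<le> -1 \<Longrightarrow> R t = 0" "\<And>t. 1 \<le> t \<Longrightarrow> R t = 1"
    using exists_smooth_step by blast
  have R_deriv: "(((deriv ^^ n) R) has_real_derivative (deriv ^^ Suc n) R t) (at t)" for n t
    using R(1) by (simp add: DERIV_deriv_iff_real_differentiable)
  \<comment> \<open>The mollified indicators need compact support in \<open>S\<close>, hence a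
    margin around [x, y]; the mollification widths \<open>e n\<close> stay below it.\<close>
  obtain \<delta> where "0 < \<delta>" and \<delta>: "{x - \<delta>..y + \<delta>} \<subseteq> S"
  proof -
    have "x \<in> S" "y \<in> S"
      using xyS \<open>x < y\<close> by auto
    then obtain d1 d2 where d: "0 < d1" "cball x d1 \<subseteq> S" "0 < d2" "cball y d2 \<subseteq> S"
      using \<open>open S\<close> open_contains_cball by metis
    have "{x - min d1 d2..y + min d1 d2} \<subseteq> S"
    proof
      fix t
      assume t: "t \<in> {x - min d1 d2..y + min d1 d2}"
      then have "t \<in> {x..y} \<or> t \<in> cball x d1 \<or> t \<in> cball y d2"
        by (auto simp: dist_real_def)
      then show "t \<in> S"
        using d xyS by blast
    qed
    then show thesis
      using d that[of "min d1 d2"] by simp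
  qed
  define K where "K = {x - \<delta>..y + \<delta>}"
  have v_K: "v absolutely_integrable_on K"
    using weak \<delta> by (auto simp: has_weak_derivative_on_def locally_integrable_on_def K_def)
  have f_cont: "continuous_on S f" and fu: "AE x in lebesgue. x \<in> S \<longrightarrow> f x = u x"
    using rep by (auto simp: continuous_representative_on_def)
  define e where "e n = \<delta> * inverse (real (Suc n))" for n
  have e_pos: "0 < e n" and e_le: "e n \<le> \<delta>" for n
    using \<open>0 < \<delta>\<close> by (auto simp: e_def field_simps)
  have e_lim: "e \<longlonglongrightarrow> 0"
    unfolding e_def using tendsto_mult_right_zero[OF LIMSEQ_inverse_real_of_nat] .
  \<comment> \<open>The first step switches on near \<open>x\<close> and the second cancels it near
    \<open>y\<close>.\<close>
  define \<Phi> where "\<Phi> n t = R ((t - x) / e n) - R ((t - y) / e n)" for n t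
  define k where "k n z t = deriv R ((t - z) / e n) / e n" for n z t
  have \<Phi>_out: "\<Phi> n t = 0" if "t \<notin> K" for n t
  proof -
    have "t < x - \<delta> \<or> t > y + \<delta>"
      using that by (auto simp: K_def)
    then consider "t < x - \<delta>" | "t > y + \<delta>"
      by blast
    then show ?thesis
    proof cases
      case 1
      then have "(t - x) / e n \<le> -1" "(t - y) / e n \<le> -1"
        using e_pos[of n] e_le[of n] \<open>x < y\<close> by (auto simp: field_simps)
      then show ?thesis
        by (simp add: \<Phi>_def R(5))
    next
      case 2
      then have "(t - x) / e n \<ge> 1" "(t - y) / e n \<ge> 1"
        using e_pos[of n] e_le[of n] \<open>x < y\<close> by (auto simp: field_simps)
      then show ?thesis
        by (simp add: \<Phi>_def R(6))
    qed
  qed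
  have dR: "continuous_on UNIV (deriv R)"
  proof -
    have "deriv R differentiable at t" for t
      using R(1)[of 1 t] by simp
    then show ?thesis
      by (simp add: continuous_on_eq_continuous_at differentiable_imp_continuous_within)
  qed
  have \<Phi>_deriv: "deriv (\<Phi> n) t = k n x t - k n y t" for n t
  proof (rule DERIV_imp_deriv)
    have "((\<lambda>t. R ((t - z) / e n)) has_real_derivative k n z t) (at t)" for z
      unfolding k_def
      by (rule DERIV_chain'[OF _ R_deriv[of 0, simplified], THEN DERIV_cong])
         (use e_pos[of n] in \<open>auto intro!: derivative_eq_intros\<close>)
    then show "(\<Phi> n has_real_derivative k n x t - k n y t) (at t)"
      unfolding \<Phi>_def by (intro DERIV_diff)
  qed
  have \<Phi>_test: "\<Phi> n \<in> test_functions S" for n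
  proof -
    \<comment> \<open>The prefactor \<open>c\<close> absorbs the factor 1 / \<open>e n\<close> that
      each use of the chain rule produces.\<close>
    define F where "F = {\<lambda>t. c * ((deriv ^^ m) R ((t - x) / e n) - (deriv ^^ m) R ((t - y) / e n)) | c m. True}"
    have "((deriv ^^ m) (\<Phi> n)) differentiable (at t)" for m t
    proof (rule derivs_differentiable_if_closed)
      show "\<Phi> n \<in> F"
        unfolding F_def \<Phi>_def by (auto intro!: exI[of _ "1::real"] exI[of _ "0::nat"])
      fix g
      assume "g \<in> F"
      then obtain c m where g: "g = (\<lambda>t. c * ((deriv ^^ m) R ((t - x) / e n) - (deriv ^^ m) R ((t - y) / e n)))"
        by (auto simp: F_def)
      have "((\<lambda>t. (deriv ^^ m) R ((t - z) / e n)) has_real_derivative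
          (deriv ^^ Suc m) R ((t - z) / e n) / e n) (at t)" for z t
        by (rule DERIV_chain'[OF _ R_deriv, THEN DERIV_cong])
           (use e_pos[of n] in \<open>auto intro!: derivative_eq_intros\<close>)
      then have "(g has_real_derivative c * ((deriv ^^ Suc m) R ((t - x) / e n) / e n
          - (deriv ^^ Suc m) R ((t - y) / e n) / e n)) (at t)" for t
        unfolding g by (intro DERIV_cmult DERIV_diff)
      then have D: "(g has_real_derivative c / e n * ((deriv ^^ Suc m) R ((t - x) / e n)
          - (deriv ^^ Suc m) R ((t - y) / e n))) (at t)" for t
        by (rule DERIV_cong) (simp add: right_diff_distrib diff_divide_distrib)
      then have "deriv g = (\<lambda>t. c / e n * ((deriv ^^ Suc m) R ((t - x) / e n)
          - (deriv ^^ Suc m) R ((t - y) / e n)))"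
        by (intro ext DERIV_imp_deriv)
      then have "deriv g \<in> F"
        unfolding F_def by blast
      then show "(\<forall>t. g differentiable at t) \<and> deriv g \<in> F"
        using D real_differentiable_def by blast
    qed
    then show ?thesis
      using \<delta> \<Phi>_out unfolding test_functions_def K_def by (auto intro!: exI[of _ "{x - \<delta>..y + \<delta>}"])
  qed
  \<comment> \<open>The weak identity is stated for \<open>u\<close>; equality almost everywhere on
    \<open>S\<close> transfers it to \<open>f\<close>, whose continuity gives meaning to the limits
    at the points \<open>x\<close> and \<open>y\<close>.\<close>
  have weak_eq: "(LINT t:S|lebesgue. f t * deriv (\<Phi> n) t) = - (LINT t:S|lebesgue. v t * \<Phi> n t)" for n
  proof -
    have "continuous_on UNIV (deriv (\<Phi> n))"
      unfolding \<Phi>_deriv[abs_def] k_def using e_pos[of n]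
      by (intro continuous_intros continuous_on_compose2[OF dR]) auto
    then have d: "deriv (\<Phi> n) \<in> borel_measurable lebesgue"
      by (intro measurable_completion) (simp add: borel_measurable_continuous_onI)
    have f_meas: "(\<lambda>t. indicator S t * f t) \<in> borel_measurable lebesgue"
      using borel_measurable_continuous_on_indicator[OF _ f_cont] \<open>open S\<close>
      by (intro measurable_completion) simp
    have u_meas: "(\<lambda>t. indicator S t * u t) \<in> borel_measurable lebesgue"
      using weak \<open>open S\<close> unfolding has_weak_derivative_on_def
      by (blast intro: locally_integrable_on_measurable)
    have "(LINT t|lebesgue. indicator S t * f t * deriv (\<Phi> n) t)
        = (LINT t|lebesgue. indicator S t * u t * deriv (\<Phi> n) t)"
    proof (rule integral_cong_AE)
      show "AE t in lebesgue. indicator S t * f t * deriv (\<Phi> n) t = indicator S t * u t * deriv (\<Phi> n) t"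
        using fu by eventually_elim (auto split: split_indicator)
    qed (intro borel_measurable_times[OF f_meas d] borel_measurable_times[OF u_meas d])+
    then show ?thesis
      using weak \<Phi>_test[of n]
      by (simp add: has_weak_derivative_on_def set_lebesgue_integral_def mult.assoc)
  qed
  have "(\<lambda>n. LINT t:S|lebesgue. f t * deriv (\<Phi> n) t) \<longlonglongrightarrow> f x - f y"
  proof -
    define J where "J z = {z - \<delta>..z + \<delta>}" for z
    have J: "J z \<subseteq> S" if "z \<in> {x, y}" for z
      using that \<delta> \<open>x < y\<close> by (force simp: J_def)
    have fJ: "continuous_on (J z) f" if "z \<in> {x, y}" for z
      using f_cont J[OF that] continuous_on_subset by blast
    have lim: "(\<lambda>n. LINT t:J z|lebesgue. f t * k n z t) \<longlonglongrightarrow> f z" if "z \<in> {x, y}" for z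
      unfolding k_def J_def
      by (rule smooth_step_integral_tendsto[where R = R])
         (use R R_deriv[of 0, simplified] dR fJ[OF that, unfolded J_def] e_pos e_le e_lim \<open>0 < \<delta>\<close> in auto)
    have int: "(\<lambda>t. f t * k n z t) absolutely_integrable_on J z" if "z \<in> {x, y}" for n z
    proof -
      have "continuous_on (J z) (k n z)"
        unfolding k_def using e_pos[of n]
        by (intro continuous_intros continuous_on_compose2[OF dR]) auto
      then show ?thesis
        using fJ[OF that] unfolding J_def
        by (intro absolutely_integrable_continuous_real continuous_intros)
    qed
    \<comment> \<open>Off \<open>J z\<close> the distance to \<open>z\<close> exceeds \<delta> \<ge>
      \<open>e n\<close>, so the kernel at \<open>z\<close> vanishes and the integral over
      \<open>S\<close> localises.\<close>
    have ind: "indicator S t * (f t * k n z t) = indicator (J z) t * (f t * k n z t)"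
      if "z \<in> {x, y}" for n z t
    proof (cases "t \<in> J z")
      case False
      then have "1 \<le> \<bar>(t - z) / e n\<bar>"
        using e_pos[of n] e_le[of n] by (auto simp: J_def abs_divide field_simps)
      then show ?thesis
        by (simp add: k_def R(3))
    qed (use J[OF that] in auto)
    have "(LINT t:S|lebesgue. f t * deriv (\<Phi> n) t)
        = (LINT t:J x|lebesgue. f t * k n x t) - (LINT t:J y|lebesgue. f t * k n y t)" for n
      using int[of x n] int[of y n]
      by (simp add: set_lebesgue_integral_def set_integrable_def \<Phi>_deriv right_diff_distrib ind)
    then show ?thesis
      using tendsto_diff[OF lim[of x] lim[of y]] by simp
  qed
  \<comment> \<open>The dominating function is |v| on \<open>K\<close>, since \<Phi> is bounded by 1
    in absolute value and vanishes off \<open>K\<close>.\<close>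
  moreover have "(\<lambda>n. LINT t:S|lebesgue. v t * \<Phi> n t) \<longlonglongrightarrow> (LINT t:{x..y}|lebesgue. v t)"
    unfolding set_lebesgue_integral_def
  proof (rule integral_dominated_convergence)
    have vK: "integrable lebesgue (\<lambda>t. indicator K t * v t)"
      using v_K by (simp add: set_integrable_def)
    then show "integrable lebesgue (\<lambda>t. \<bar>indicator K t * v t\<bar>)"
      by (rule integrable_abs)
    have v_meas: "(\<lambda>t. indicator K t * v t) \<in> borel_measurable lebesgue"
      using vK by (rule borel_measurable_integrable)
    have "(\<lambda>t. indicator {x..y} t * (indicator K t * v t)) \<in> borel_measurable lebesgue"
      by (intro borel_measurable_times[OF _ v_meas] borel_measurable_indicator) simp
    also have "(\<lambda>t. indicator {x..y} t * (indicator K t * v t)) = (\<lambda>t. indicator {x..y} t *\<^sub>R v t)"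
      using \<open>0 < \<delta>\<close> by (auto simp: K_def fun_eq_iff split: split_indicator)
    finally show "(\<lambda>t. indicator {x..y} t *\<^sub>R v t) \<in> borel_measurable lebesgue" .
    have ind: "indicator S t *\<^sub>R (v t * \<Phi> n t) = indicator K t * v t * \<Phi> n t" for n t
      using \<delta> \<Phi>_out[of t n] by (auto simp: K_def split: split_indicator)
    have "\<Phi> n \<in> borel_measurable lebesgue" for n
    proof -
      have cR: "continuous_on UNIV R"
        using R_deriv[of 0, simplified] by (rule DERIV_continuous_on)
      have "continuous_on UNIV (\<Phi> n)"
        unfolding \<Phi>_def using e_pos[of n]
        by (intro continuous_intros continuous_on_compose2[OF cR]) auto
      then show ?thesis
        by (intro measurable_completion) (simp add: borel_measurable_continuous_onI)
    qed
    then show "(\<lambda>t. indicator S t *\<^sub>R (v t * \<Phi> n t)) \<in> borel_measurable lebesgue" for n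
      unfolding ind by (rule borel_measurable_times[OF v_meas])
    have "\<bar>\<Phi> n t\<bar> \<le> 1" for n t
      using R(4)[of "(t - x) / e n"] R(4)[of "(t - y) / e n"] unfolding \<Phi>_def by linarith
    then show "AE t in lebesgue. norm (indicator S t *\<^sub>R (v t * \<Phi> n t)) \<le> \<bar>indicator K t * v t\<bar>" for n
      unfolding ind by (intro AE_I2) (simp add: abs_mult mult_left_le)
    \<comment> \<open>At t = x or t = y the argument of one step is 0 for all \<open>n\<close>, so
      the limit need not be the indicator; these two points are discarded as a null set.\<close>
    have "{x, y} \<in> null_sets lebesgue"
      by (simp add: negligible_iff_null_sets[symmetric])
    from AE_not_in[OF this]
    show "AE t in lebesgue. (\<lambda>n. indicator S t *\<^sub>R (v t * \<Phi> n t)) \<longlonglongrightarrow> indicator {x..y} t *\<^sub>R v t"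
    proof eventually_elim
      case (elim t)
      have R_lim: "(\<lambda>n. R ((t - z) / e n)) \<longlonglongrightarrow> (if z < t then 1 else 0)" if "t \<noteq> z" for z
      proof (rule Lim_transform_eventually[OF tendsto_const])
        have "\<forall>\<^sub>F n in sequentially. e n < \<bar>t - z\<bar>"
          using e_lim that by (intro order_tendstoD) auto
        then show "\<forall>\<^sub>F n in sequentially. (if z < t then 1 else 0) = R ((t - z) / e n)"
        proof eventually_elim
          case (elim n)
          then show ?case
            using e_pos[of n] R(5)[of "(t - z) / e n"] R(6)[of "(t - z) / e n"] that
            by (auto simp: field_simps)
        qed
      qed
      have "(\<lambda>n. \<Phi> n t) \<longlonglongrightarrow> (if x < t then 1 else 0) - (if y < t then 1 else 0)"
        unfolding \<Phi>_def using elim by (intro tendsto_diff R_lim) auto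
      from tendsto_mult_left[OF this, of "indicator S t * v t"] show ?case
        using elim \<open>x < y\<close> subsetD[OF xyS, of t] by (auto simp: mult.assoc split: split_indicator if_splits)
    qed
  qed
  ultimately have "f x - f y = - (LINT t:{x..y}|lebesgue. v t)"
    unfolding weak_eq by (metis LIMSEQ_unique tendsto_minus)
  then show ?thesis
    by simp
qed

section \<open>Topology of \<open>I_set\<close> and its components\<close>

text \<open>A point within \<epsilon> / 2 of \<open>x\<close> inherits the finite dual integral on
  its own interval of radius \<epsilon> / 2, which lies in the interval around
  \<open>x\<close>.\<close>

lemma open_I_set:
  assumes "open \<Omega>"
  shows "open (I_set p \<Omega> w)"
  unfolding open_dist
proof
  fix x
  assume "x \<in> I_set p \<Omega> w"
  then obtain \<epsilon> where x: "x \<in> \<Omega>" "0 < \<epsilon>"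
      "(\<integral>\<^sup>+ y\<in>{x - \<epsilon><..<x + \<epsilon>}. dual_weight p w y \<partial>lebesgue) < \<infinity>"
    by (auto simp: I_set_def)
  obtain d where d: "0 < d" "\<And>y. dist y x < d \<Longrightarrow> y \<in> \<Omega>"
    using assms x(1) unfolding open_dist by blast
  have "y \<in> I_set p \<Omega> w" if y: "dist y x < min d (\<epsilon> / 2)" for y
  proof -
    have "(\<integral>\<^sup>+ z\<in>{y - \<epsilon> / 2<..<y + \<epsilon> / 2}. dual_weight p w z \<partial>lebesgue)
        \<le> (\<integral>\<^sup>+ z\<in>{x - \<epsilon><..<x + \<epsilon>}. dual_weight p w z \<partial>lebesgue)"
      by (rule nn_integral_mono)
         (use y in \<open>auto simp: dist_real_def split: split_indicator\<close>)
    then show ?thesis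
      using x y d(2)[of y] by (auto simp: I_set_def intro!: exI[of _ "\<epsilon> / 2"])
  qed
  then show "\<exists>e>0. \<forall>y. dist y x < e \<longrightarrow> y \<in> I_set p \<Omega> w"
    using x d by (intro exI[of _ "min d (\<epsilon> / 2)"]) auto
qed

text \<open>Openness makes the bounds by infimum and supremum strict; connectedness fills in
  everything between them.\<close>

lemma open_connected_bounded_eq_interval:
  fixes C :: "real set"
  assumes "open C" "connected C" "bounded C" "C \<noteq> {}"
  shows "C = {Inf C<..<Sup C}"
proof -
  have bdd: "bdd_above C" "bdd_below C"
    using assms(3) by (auto simp: bounded_imp_bdd_above bounded_imp_bdd_below)
  show ?thesis
  proof (intro subset_antisym subsetI)
    fix x
    assume "x \<in> C"
    then obtain d where d: "0 < d" "cball x d \<subseteq> C"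
      using assms(1) open_contains_cball by blast
    then have "x - d \<in> C" "x + d \<in> C"
      by (auto simp: subset_iff dist_real_def)
    then show "x \<in> {Inf C<..<Sup C}"
      using d(1) bdd cInf_lower[of "x - d" C] cSup_upper[of "x + d" C] by auto
  next
    fix x
    assume "x \<in> {Inf C<..<Sup C}"
    then obtain y z where "y \<in> C" "y < x" "z \<in> C" "x < z"
      using assms(4) bdd by (auto simp: cInf_less_iff less_cSup_iff)
    then show "x \<in> C"
      using connected_contains_Icc[OF assms(2), of y z] by auto
  qed
qed

section \<open>The estimate on one component and the summation\<close>

text \<open>The increment formula is used only between the midpoint and an interior point, so the
  endpoints, near which \<open>v\<close> may fail to be integrable, are never reached.\<close>

lemma component_term_le_energy:
  assumes p: "1 < p" and "\<alpha> < \<beta>"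
    and w: "AE x in lebesgue. 0 \<le> w x" "w \<in> borel_measurable lebesgue"
    and v: "\<And>x y. \<lbrakk>\<alpha> < x; y < \<beta>\<rbrakk> \<Longrightarrow> v absolutely_integrable_on {x..y}"
    and f: "\<And>x y. \<lbrakk>\<alpha> < x; x < y; y < \<beta>\<rbrakk> \<Longrightarrow> f y - f x = (LINT t:{x..y}|lebesgue. v t)"
  shows "component_term p w f \<alpha> \<beta> \<le> (\<integral>\<^sup>+ y\<in>{\<alpha><..<\<beta>}. ennreal (\<bar>v y\<bar> powr p * w y) \<partial>lebesgue)"
proof -
  define E where "E = (\<integral>\<^sup>+ y\<in>{\<alpha><..<\<beta>}. ennreal (\<bar>v y\<bar> powr p * w y) \<partial>lebesgue)"
  define m where "m = (\<alpha> + \<beta>) / 2"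
  have m: "\<alpha> < m" "m < \<beta>"
    using \<open>\<alpha> < \<beta>\<close> by (auto simp: m_def)
  have incr: "\<bar>f y - f x\<bar> \<le> (LINT t:{x..y}|lebesgue. \<bar>v t\<bar>)" if "\<alpha> < x" "x \<le> y" "y < \<beta>" for x y
  proof (cases "x = y")
    case True
    then show ?thesis
      by (simp add: set_lebesgue_integral_def)
  next
    case False
    then have "\<bar>f y - f x\<bar> = norm (LINT t:{x..y}|lebesgue. v t)"
      using f that by simp
    also have "\<dots> \<le> (LINT t:{x..y}|lebesgue. norm (v t))"
      using that by (intro set_integral_norm_bound v)
    finally show ?thesis
      by simp
  qed
  have bound: "ennreal (\<bar>f \<eta> - f m\<bar> powr p * hat_weight p w \<alpha> \<beta> \<eta> powr (p - 1)) \<le> E"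
    if \<eta>: "\<alpha> < \<eta>" "\<eta> < \<beta>" for \<eta>
  proof -
    define K where "K = {min \<eta> m..max \<eta> m}"
    define K' where "K' = (if \<eta> < (3 * \<alpha> + \<beta>) / 4 then {\<eta>..m}
      else if \<eta> \<le> (\<alpha> + 3 * \<beta>) / 4 then {(3 * \<alpha> + \<beta>) / 4..(\<alpha> + 3 * \<beta>) / 4} else {m..\<eta>})"
    have hat: "hat_weight p w \<alpha> \<beta> \<eta> = inverse (enn2real (\<integral>\<^sup>+ y\<in>K'. dual_weight p w y \<partial>lebesgue))"
      by (simp add: hat_weight_def K'_def m_def)
    \<comment> \<open>In the outer branches \<open>K'\<close> is exactly the interval between \<eta>
      and the midpoint; in the middle branch it is a fixed interval that contains both
      points.\<close>
    have "K \<subseteq> K'"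
      using \<open>\<alpha> < \<beta>\<close> by (cases "\<eta> \<le> m") (auto simp: K_def K'_def m_def)
    moreover have "\<bar>f \<eta> - f m\<bar> \<le> (LINT t:K|lebesgue. \<bar>v t\<bar>)"
      using incr[of \<eta> m] incr[of m \<eta>] \<eta> m by (cases "\<eta> \<le> m") (auto simp: K_def)
    moreover have "v absolutely_integrable_on K"
      unfolding K_def using \<eta> m by (intro v) auto
    ultimately have "ennreal (\<bar>f \<eta> - f m\<bar> powr p * hat_weight p w \<alpha> \<beta> \<eta> powr (p - 1))
        \<le> (\<integral>\<^sup>+ y\<in>K. ennreal (\<bar>v y\<bar> powr p * w y) \<partial>lebesgue)"
      unfolding hat by (intro powr_bound_by_energy p w) (auto simp: K_def)
    also have "\<dots> \<le> E"
      unfolding E_def by (rule nn_integral_mono) (use \<eta> m in \<open>auto simp: K_def split: split_indicator\<close>)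
    finally show ?thesis .
  qed
  have "component_term p w f \<alpha> \<beta> \<le> ennreal (1 / (\<beta> - \<alpha>)) * (\<integral>\<^sup>+ \<eta>. E * indicator {\<alpha><..<\<beta>} \<eta> \<partial>lebesgue)"
    unfolding component_term_def m_def[symmetric]
    by (intro mult_left_mono nn_integral_mono) (auto simp: bound split: split_indicator)
  also have "\<dots> = E * (ennreal (1 / (\<beta> - \<alpha>)) * ennreal (\<beta> - \<alpha>))"
    using \<open>\<alpha> < \<beta>\<close> by (simp add: nn_integral_cmult_indicator mult_ac)
  also have "\<dots> = E"
    using \<open>\<alpha> < \<beta>\<close> by (simp add: ennreal_mult[symmetric])
  finally show ?thesis
    unfolding E_def .
qed

text \<open>An infinite sum in \<open>ennreal\<close> is the supremum of its finite partial sums,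
  and for a finite disjoint family the indicators add up to that of the union.\<close>

lemma infsum_nn_integral_disjoint_le:
  fixes g :: "'a \<Rightarrow> ennreal"
  assumes "disjoint \<C>" "\<And>C. C \<in> \<C> \<Longrightarrow> C \<subseteq> S"
    and "\<And>C. C \<in> \<C> \<Longrightarrow> (\<lambda>x. g x * indicator C x) \<in> borel_measurable M"
  shows "(\<Sum>\<^sub>\<infinity>C\<in>\<C>. \<integral>\<^sup>+x\<in>C. g x \<partial>M) \<le> (\<integral>\<^sup>+x\<in>S. g x \<partial>M)"
proof -
  have "(\<Sum>C\<in>F. \<integral>\<^sup>+x\<in>C. g x \<partial>M) \<le> (\<integral>\<^sup>+x\<in>S. g x \<partial>M)" if F: "finite F" "F \<subseteq> \<C>" for F
  proof -
    have "disjoint_family_on (\<lambda>C. C) F"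
      using assms(1) F(2) by (auto simp: disjoint_family_on_def disjoint_def)
    then have ind: "(\<Sum>C\<in>F. indicator C x) = (indicator (\<Union>F) x :: ennreal)" for x
    proof -
      have "(indicator (\<Union>C\<in>F. C) x :: ennreal) = (\<Sum>C\<in>F. indicator C x)"
        using F(1) \<open>disjoint_family_on (\<lambda>C. C) F\<close> by (rule indicator_UN_disjoint)
      then show ?thesis
        by simp
    qed
    have "(\<Sum>C\<in>F. \<integral>\<^sup>+x\<in>C. g x \<partial>M) = (\<integral>\<^sup>+x. (\<Sum>C\<in>F. g x * indicator C x) \<partial>M)"
      using assms(3) F by (intro nn_integral_sum[symmetric]) auto
    also have "\<dots> = (\<integral>\<^sup>+x\<in>\<Union>F. g x \<partial>M)"
      by (simp add: sum_distrib_left[symmetric] ind)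
    also have "\<dots> \<le> (\<integral>\<^sup>+x\<in>S. g x \<partial>M)"
      by (rule nn_integral_mono) (use F assms(2) in \<open>auto split: split_indicator\<close>)
    finally show ?thesis .
  qed
  then show ?thesis
    by (subst nonneg_infsum_complete) (auto intro!: SUP_least)
qed

theorem theorem2p10:
  fixes p a b :: real and \<Omega> :: "real set" and w u ubar u' :: "real \<Rightarrow> real"
  assumes "1 < p"
    and "a < b" and "\<Omega> = {a<..<b}"
    and "AE x in lebesgue. 0 \<le> w x"
    and "w locally_integrable_on UNIV"
    and "components (I_set p \<Omega> w) \<noteq> {}"
    and "u \<in> Dom p \<Omega> w"
    and "continuous_representative_on ubar u (I_set p \<Omega> w)"
    and "has_weak_derivative_on u u' (I_set p \<Omega> w)"
  shows "(\<Sum>\<^sub>\<infinity>C\<in>components (I_set p \<Omega> w). component_term p w ubar (Inf C) (Sup C))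
           \<le> (\<integral>\<^sup>+ y\<in>I_set p \<Omega> w. ennreal (\<bar>u' y\<bar> powr p * w y) \<partial>lebesgue)"
proof -
  let ?I = "I_set p \<Omega> w"
  define g where "g y = ennreal (\<bar>u' y\<bar> powr p * w y)" for y
  have "open ?I"
    using assms(3) by (simp add: open_I_set)
  have w[measurable]: "w \<in> borel_measurable lebesgue"
    using locally_integrable_on_measurable[OF assms(5)] by simp
  have u'_loc: "u' locally_integrable_on ?I"
    using assms(9) by (simp add: has_weak_derivative_on_def)
  have C: "C \<subseteq> ?I \<and> open C \<and> C = {Inf C<..<Sup C} \<and> Inf C < Sup C" if "C \<in> components ?I" for C
  proof -
    have "C \<subseteq> ?I" "C \<noteq> {}" "connected C"
      using that by (auto simp: in_components_subset in_components_nonempty in_components_connected)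
    moreover have "open C"
      using that \<open>open ?I\<close> by (rule open_components[rotated])
    moreover have "bounded C"
    proof (rule bounded_subset)
      show "C \<subseteq> {a<..<b}"
        using \<open>C \<subseteq> ?I\<close> assms(3) by (auto simp: I_set_def)
    qed (metis bounded_box box_real(1))
    ultimately show ?thesis
      using open_connected_bounded_eq_interval[of C] by (metis greaterThanLessThan_empty_iff not_le)
  qed
  have "component_term p w ubar (Inf C) (Sup C) \<le> (\<integral>\<^sup>+ y\<in>C. g y \<partial>lebesgue)"
    if "C \<in> components ?I" for C
  proof -
    have sub: "{x..y} \<subseteq> ?I" if "Inf C < x" "y < Sup C" for x y
    proof -
      have "{x..y} \<subseteq> {Inf C<..<Sup C}"
        using that by auto
      then show ?thesis
        using C[OF \<open>C \<in> components ?I\<close>] by blast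
    qed
    have "component_term p w ubar (Inf C) (Sup C) \<le> (\<integral>\<^sup>+ y\<in>{Inf C<..<Sup C}. g y \<partial>lebesgue)"
      unfolding g_def
    proof (rule component_term_le_energy)
      show "u' absolutely_integrable_on {x..y}" if "Inf C < x" "y < Sup C" for x y
        using u'_loc sub[OF that] by (simp add: locally_integrable_on_def)
      show "ubar y - ubar x = (LINT t:{x..y}|lebesgue. u' t)" if "Inf C < x" "x < y" "y < Sup C" for x y
        using \<open>open ?I\<close> assms(9,8) that(2) sub[OF that(1,3)] by (rule continuous_representative_increment)
    qed (use assms w C[OF that] in auto)
    then show ?thesis
      using C[OF that] by metis
  qed
  then have "(\<Sum>\<^sub>\<infinity>C\<in>components ?I. component_term p w ubar (Inf C) (Sup C))
      \<le> (\<Sum>\<^sub>\<infinity>C\<in>components ?I. \<integral>\<^sup>+ y\<in>C. g y \<partial>lebesgue)"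
    by (intro infsum_mono nonneg_summable_on_complete) auto
  also have "\<dots> \<le> (\<integral>\<^sup>+ y\<in>?I. g y \<partial>lebesgue)"
  proof (rule infsum_nn_integral_disjoint_le)
    show "disjoint (components ?I)"
      using pairwise_disjoint_components[of ?I] by (simp add: disjoint_def pairwise_def disjnt_def)
    fix C
    assume "C \<in> components ?I"
    note C = C[OF this]
    then have [measurable]: "C \<in> sets lebesgue"
      by auto
    have [measurable]: "(\<lambda>x. indicator ?I x * u' x) \<in> borel_measurable lebesgue"
      by (rule locally_integrable_on_measurable[OF u'_loc \<open>open ?I\<close>])
    \<comment> \<open>Only the product of \<open>u'\<close> with the indicator of
      \<open>I_set p \<Omega> w\<close> is known to be measurable; on the component \<open>C\<close>
      it agrees with \<open>u'\<close>.\<close>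
    have "(\<lambda>x. ennreal (\<bar>indicator ?I x * u' x\<bar> powr p * w x) * indicator C x) \<in> borel_measurable lebesgue"
      by measurable
    also have "(\<lambda>x. ennreal (\<bar>indicator ?I x * u' x\<bar> powr p * w x) * indicator C x)
        = (\<lambda>x. g x * indicator C x)"
      using C by (auto simp: g_def fun_eq_iff split: split_indicator)
    finally show "(\<lambda>x. g x * indicator C x) \<in> borel_measurable lebesgue" .
  qed (use C in auto)
  finally show ?thesis
    by (simp add: g_def)
qed

end
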